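(* Let $q$ be a complex number with $|q|<1$. Then \[ \sum_{k=0}^{\infty}\frac{1+q^{4k+2}}{(1+q^{2k+1})^2}\,\frac{q^{2k}}{(1-q^{2k+1})^2} =\frac{(-q^2;q^2)_{\infty}^2\,(q^4;q^4)_{\infty}^4}{(q^2;q^4)_{\infty}^2}. \]
   Context: For complex $x,q$ with $|q|<1$, $(x;q)_\infty=\prod_{i=0}^{\infty}(1-xq^i)$. *)

theory Defs
  imports "HOL-Analysis.Analysis"
begin

definition qpoch_inf :: "complex \<Rightarrow> complex \<Rightarrow> complex" where
  "qpoch_inf x q = (\<Prod>i. 1 - x * q ^ i)"

text \<open>
  For \<open>norm q < 1\<close> the product always converges, so \<^const>\<open>prodinf\<close> never takes its
  default value; vanishing factors are allowed and then make the product zero.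
\<close>

lemma convergent_prod_qpoch_inf:
  fixes x q :: complex
  assumes "norm q < 1"
  shows "convergent_prod (\<lambda>i. 1 - x * q ^ i)"
proof (rule abs_convergent_prod_imp_convergent_prod)
  have "summable (\<lambda>i. norm x * norm q ^ i)"
    using assms by (intro summable_mult summable_geometric) simp
  then show "abs_convergent_prod (\<lambda>i. 1 - x * q ^ i)"
    by (simp add: abs_convergent_prod_conv_summable norm_mult norm_power)
qed

lemma has_prod_qpoch_inf:
  "norm q < 1 \<Longrightarrow> (\<lambda>i. 1 - x * q ^ i) has_prod qpoch_inf x q"
  unfolding qpoch_inf_def
  by (rule convergent_prod_has_prod[OF convergent_prod_qpoch_inf])

end

theory Submission
  imports Defs
begin

text \<open>
  Write \<open>a\<^sub>n = q\<^sup>n / (1 + q\<^bsup>2n+1\<^esup>)\<close> and \<open>A = \<Sum>\<^sub>n a\<^sub>n\<close>. A terminating sum deforming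
  \<open>A\<close> is evaluated by the Wilf-Zeilberger method, and its limit gives
  \<open>A = (q\<^sup>4;q\<^sup>4)\<^sup>2 / (q\<^sup>2;q\<^sup>4)\<^sup>2\<close>; with Euler's identity
  \<open>(-q\<^sup>2;q\<^sup>2) (q\<^sup>2;q\<^sup>4) = 1\<close> the right-hand side of the theorem becomes \<open>A\<^sup>2\<close>. To expand \<open>A\<^sup>2\<close>,
  the double sum of \<open>a\<^sub>m a\<^sub>n\<close> is taken once along the diagonals \<open>n - m = d\<close> and once along the
  antidiagonals \<open>m + n + 1 = d\<close>. By partial fractions the first kind of sum telescopes, and for each
  \<open>d \<ge> 1\<close> the two kinds together leave \<open>d q\<^bsup>d-1\<^esup> / (1 - q\<^bsup>2d\<^esup>)\<close>. So \<open>2 A\<^sup>2\<close> is a Lambert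
  series plus \<open>\<Sum>\<^sub>n a\<^sub>n\<^sup>2\<close>, and interchanging summations in the Lambert series gives the result.
\<close>

section \<open>Finite products in the bases q and q^2\<close>

definition qpoch :: "complex \<Rightarrow> complex \<Rightarrow> nat \<Rightarrow> complex" where
  "qpoch x q n = (\<Prod>i<n. 1 - x * q ^ i)"

lemma qpoch_0 [simp]: "qpoch x q 0 = 1"
  by (simp add: qpoch_def)

lemma qpoch_Suc: "qpoch x q (Suc n) = qpoch x q n * (1 - x * q ^ n)"
  by (simp add: qpoch_def)

lemma qpoch_square_Suc:
  "qpoch q (q\<^sup>2) (Suc n) = qpoch q (q\<^sup>2) n * (1 - q ^ (2 * n + 1))"
  "qpoch (- q) (q\<^sup>2) (Suc n) = qpoch (- q) (q\<^sup>2) n * (1 + q ^ (2 * n + 1))"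
  "qpoch (q\<^sup>2) (q\<^sup>2) (Suc n) = qpoch (q\<^sup>2) (q\<^sup>2) n * (1 - q ^ (2 * n + 2))"
  "qpoch (- (q\<^sup>2)) (q\<^sup>2) (Suc n) = qpoch (- (q\<^sup>2)) (q\<^sup>2) n * (1 + q ^ (2 * n + 2))"
  by (simp_all add: qpoch_Suc power_mult power2_eq_square)

lemma power_neq_one:
  fixes q :: complex
  assumes "norm q < 1" "n > 0"
  shows "q ^ n \<noteq> 1" "q ^ n \<noteq> -1"
proof -
  have "norm (q ^ n) < 1"
    using assms by (simp add: norm_power power_Suc_less_one power_less_one_iff)
  then show "q ^ n \<noteq> 1" "q ^ n \<noteq> -1" by auto
qed

lemma qpoch_nonzero:
  assumes "norm q < 1" "norm x < 1"
  shows "qpoch x q n \<noteq> 0"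
proof -
  have "norm (x * q ^ i) < 1" for i
  proof -
    have "norm (x * q ^ i) \<le> norm x * 1"
      unfolding norm_mult norm_power using assms by (intro mult_left_mono power_le_one) auto
    then show ?thesis using assms by simp
  qed
  then have "x * q ^ i \<noteq> 1" for i by (metis norm_one less_irrefl)
  then show ?thesis unfolding qpoch_def by (subst prod_zero_iff) auto
qed

section \<open>Wilf-Zeilberger evaluation of a terminating sum\<close>

definition odd_term :: "complex \<Rightarrow> nat \<Rightarrow> complex" where
  "odd_term q n = q ^ n / (1 + q ^ (2 * n + 1))"

text \<open>For fixed \<open>j\<close> the factor attached to \<open>odd_term q j\<close> tends, as
  \<open>n\<close> grows, to the square of (q;q^2)_inf / (q^2;q^2)_inf, which does not depend on
  \<open>j\<close>. Only \<open>j \<le> n\<close> is meaningful, since \<open>n - j\<close> is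
  truncated.\<close>

definition wz_term :: "complex \<Rightarrow> nat \<Rightarrow> nat \<Rightarrow> complex" where
  "wz_term q n j = odd_term q j *
     (qpoch q (q\<^sup>2) (n - j) * qpoch q (q\<^sup>2) (Suc n + j)
      / (qpoch (q\<^sup>2) (q\<^sup>2) (Suc n + j) * qpoch (q\<^sup>2) (q\<^sup>2) (n - j)))"

text \<open>
  For \<open>j \<le> n + 1\<close> this is the telescoping certificate, multiplied by \<open>q\<^bsup>2(n+1)\<^esup>\<close> so that no negative
  power of \<open>q\<close> occurs and \<open>q = 0\<close> needs no separate treatment.
\<close>

definition wz_cert :: "complex \<Rightarrow> nat \<Rightarrow> nat \<Rightarrow> complex" where
  "wz_cert q n j = q ^ (2 * Suc n - j) * (1 - q ^ (2 * j)) *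
     (qpoch q (q\<^sup>2) (Suc n - j) * qpoch q (q\<^sup>2) (Suc n + j)
      / (qpoch (q\<^sup>2) (q\<^sup>2) (Suc n + j) * qpoch (q\<^sup>2) (q\<^sup>2) (Suc n - j)))"

text \<open>The equation of \<open>wz_step\<close> stripped of its products, with u = q^(2n+2), v =
  q^(2j+1), t = q^(2(n-j)+1). After substituting for \<open>u\<close> and \<open>w\<close>, a
  polynomial identity in q, v, t, s remains.\<close>

lemma wz_algebra:
  fixes q v t u s w :: complex
  assumes "u = v * t" "s * (1 + v) = w"
  shows "(1 - u) * (1 - u * q) *
      ((1 + u * q)\<^sup>2 * (s * ((1 - t) * (1 - u * v)))
       - (1 + u)\<^sup>2 * (s * ((1 - u * v * q) * (1 - q * t))))
    = - (1 - q * u\<^sup>2) *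
      (w * t * (1 - q * v) * (1 - u * v) * (1 - q * t)
       - w * t * (q - v) * (1 - t) * (1 - u * v * q))"
  unfolding assms(1) assms(2)[symmetric] by algebra

text \<open>The closed form in \<open>finite_odd_sum\<close> gains the factor ((1 + u) / (1 + u
  q))^2 from \<open>n\<close> to \<open>n + 1\<close>. The corresponding combination of summands is
  a difference of certificates in \<open>j\<close>, written here without division.\<close>

lemma wz_step:
  fixes q :: complex
  assumes q: "norm q < 1" and j: "j \<le> n" and u: "u = q ^ (2 * Suc n)"
  shows "(1 - u) * (1 - u * q) *
      ((1 + u * q)\<^sup>2 * wz_term q (Suc n) j - (1 + u)\<^sup>2 * wz_term q n j)
    = - (1 - q * u\<^sup>2) * (wz_cert q n (Suc j) - wz_cert q n j)"
proof -
  obtain e where n: "n = j + e" using j le_Suc_ex by blast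
  define v where "v = q ^ (2 * j + 1)"
  define t where "t = q ^ (2 * e + 1)"
  let ?O = "qpoch q (q\<^sup>2)" and ?M = "qpoch (q\<^sup>2) (q\<^sup>2)"
  \<comment> \<open>Smaller indices in the numerator and larger ones in the denominator make both
    summands and both certificates polynomial multiples of \<open>b * odd_term q j\<close> or
    \<open>b * q ^ j\<close>.\<close>
  define b where "b = ?O e * ?O (Suc n + j) / (?M (Suc (Suc n + j)) * ?M (Suc e))"
  have q2: "norm (q\<^sup>2) < 1"
    using q by (simp add: norm_power power_less_one_iff)
  have nz: "?M k \<noteq> 0" for k using qpoch_nonzero[OF q2 q2] .
  have uvt: "u = v * t"
    by (simp add: u v_def t_def n power_add power_mult algebra_simps)
  have O1: "?O (Suc e) = ?O e * (1 - t)"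
    unfolding qpoch_square_Suc t_def ..
  have O2: "?O (Suc (Suc n + j)) = ?O (Suc n + j) * (1 - u * v)"
  proof -
    have "2 * (Suc n + j) + 1 = 2 * Suc n + (2 * j + 1)" by simp
    then show ?thesis unfolding qpoch_square_Suc by (simp only: u v_def power_add)
  qed
  have M1: "?M (Suc e) = ?M e * (1 - q * t)"
    unfolding qpoch_square_Suc t_def by simp
  have M2: "?M (Suc (Suc n + j)) = ?M (Suc n + j) * (1 - u * v * q)"
  proof -
    have "2 * (Suc n + j) + 2 = 2 * Suc n + (2 * j + 1) + 1" by simp
    then show ?thesis unfolding qpoch_square_Suc by (simp only: u v_def power_add power_one_right)
  qed
  have nz': "1 - q * t \<noteq> 0" "1 - u * v * q \<noteq> 0"
    using nz[of "Suc e"] nz[of "Suc (Suc n + j)"] unfolding M1 M2 by auto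
  have s: "b * odd_term q j * (1 + v) = b * q ^ j"
    using power_neq_one(2)[OF q, of "2 * j + 1"]
    by (simp add: odd_term_def v_def add_eq_0_iff del: power_Suc)
  have T1: "wz_term q (Suc n) j = b * odd_term q j * ((1 - t) * (1 - u * v))"
  proof -
    have i: "Suc n - j = Suc e" "Suc (Suc n) + j = Suc (Suc n + j)" using n by auto
    show ?thesis unfolding wz_term_def i O1 O2 b_def by simp
  qed
  have T0: "wz_term q n j = b * odd_term q j * ((1 - u * v * q) * (1 - q * t))"
  proof -
    have i: "n - j = e" using n by auto
    show ?thesis unfolding wz_term_def i b_def M1 M2 using nz nz' by simp
  qed
  have C1: "wz_cert q n (Suc j) = b * q ^ j * t * (1 - q * v) * (1 - u * v) * (1 - q * t)"
  proof -
    have i: "Suc n - Suc j = e" "Suc n + Suc j = Suc (Suc n + j)" using n by auto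
    have p: "q ^ (2 * Suc n - Suc j) = q ^ j * t" "q ^ (2 * Suc j) = q * v"
    proof -
      have "2 * Suc n - Suc j = j + (2 * e + 1)" using n by simp
      then show "q ^ (2 * Suc n - Suc j) = q ^ j * t" by (simp only: t_def power_add)
    qed (simp add: v_def)
    show ?thesis unfolding wz_cert_def i p b_def O2 M1 using nz nz' by simp
  qed
  have C0: "wz_cert q n j = b * q ^ j * t * (q - v) * (1 - t) * (1 - u * v * q)"
  proof -
    have i: "Suc n - j = Suc e" using n by auto
    have "2 * Suc n - j = j + Suc (2 * e + 1)" using n by simp
    then have p: "q ^ (2 * Suc n - j) = q ^ j * q * t" by (simp add: t_def power_add)
    \<comment> \<open>The spare factor \<open>q\<close> of the power in \<open>p\<close> joins
      \<open>1 - q ^ (2 * j)\<close>, which becomes expressible through \<open>v\<close>.\<close>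
    have a: "q - v = q * (1 - q ^ (2 * j))" by (simp add: v_def algebra_simps)
    show ?thesis unfolding wz_cert_def i p a b_def O1 M2 using nz nz' by (simp add: mult_ac)
  qed
  show ?thesis unfolding T0 T1 C0 C1 by (rule wz_algebra[OF uvt s])
qed

text \<open>Summing \<open>wz_step\<close> over \<open>j \<le> n\<close> leaves two boundary
  certificates. The one at \<open>j = 0\<close> vanishes, and the one at \<open>j = n + 1\<close>
  cancels against the extra summand of the next sum, so consecutive sums have the ratio of the
  closed forms.\<close>

lemma finite_odd_sum:
  fixes q :: complex
  assumes q: "norm q < 1"
  shows "(\<Sum>j\<le>n. wz_term q n j)
    = (qpoch (- (q\<^sup>2)) (q\<^sup>2) n)\<^sup>2 / (qpoch (- q) (q\<^sup>2) (Suc n))\<^sup>2"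
proof (induction n)
  case 0
  have "1 + q \<noteq> 0" "1 - q \<noteq> 0" using power_neq_one[OF q, of 1] by (auto simp: add_eq_0_iff)
  moreover have "1 - q\<^sup>2 = (1 - q) * (1 + q)" by algebra
  ultimately show ?case
    by (simp add: wz_term_def odd_term_def qpoch_Suc power2_eq_square)
next
  case (Suc n)
  define u where "u = q ^ (2 * Suc n)"
  let ?O = "qpoch q (q\<^sup>2)" and ?M = "qpoch (q\<^sup>2) (q\<^sup>2)"
  let ?S = "\<Sum>j\<le>n. wz_term q n j"
  have q2: "norm (q\<^sup>2) < 1"
    using q by (simp add: norm_power power_less_one_iff)
  have nzM: "?M k \<noteq> 0" for k using qpoch_nonzero[OF q2 q2] .
  have uq: "u * q = q ^ (2 * Suc n + 1)" by (simp add: u_def)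
  have nz: "1 - u \<noteq> 0" "1 - u * q \<noteq> 0" "1 + u * q \<noteq> 0" "1 + u \<noteq> 0"
    using power_neq_one[OF q, of "2 * Suc n"] power_neq_one[OF q, of "2 * Suc n + 1"]
    unfolding uq unfolding u_def by (auto simp: add_eq_0_iff simp del: power_Suc mult_Suc_right)
  have "(1 - u) * (1 - u * q) *
      ((1 + u * q)\<^sup>2 * (\<Sum>j\<le>n. wz_term q (Suc n) j) - (1 + u)\<^sup>2 * ?S)
    = (\<Sum>j\<le>n. (1 - u) * (1 - u * q) *
      ((1 + u * q)\<^sup>2 * wz_term q (Suc n) j - (1 + u)\<^sup>2 * wz_term q n j))"
    by (simp only: sum_distrib_left flip: sum_subtractf)
  also have "\<dots> = (\<Sum>j\<le>n. - (1 - q * u\<^sup>2) * (wz_cert q n (Suc j) - wz_cert q n j))"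
    using wz_step[OF q _ u_def] by (intro sum.cong) auto
  also have "\<dots> = - (1 - q * u\<^sup>2) * (wz_cert q n (Suc n) - wz_cert q n 0)"
    by (simp only: sum_distrib_left[symmetric] lessThan_Suc_atMost[symmetric] sum_lessThan_telescope)
  also have "wz_cert q n 0 = 0" by (simp add: wz_cert_def)
  finally have sum: "(1 - u) * (1 - u * q) *
      ((1 + u * q)\<^sup>2 * (\<Sum>j\<le>n. wz_term q (Suc n) j) - (1 + u)\<^sup>2 * ?S)
    = - (1 - q * u\<^sup>2) * wz_cert q n (Suc n)" by simp
  define c where "c = q ^ Suc n * (?O (2 * Suc n) / ?M (2 * Suc n))"
  have cert: "wz_cert q n (Suc n) = c * (1 - u)"
  proof -
    have "2 * Suc n - Suc n = Suc n" "Suc n + Suc n = 2 * Suc n" "Suc n - Suc n = 0" by simp_all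
    then show ?thesis by (simp only: wz_cert_def c_def u_def qpoch_0 mult_1) (simp add: mult_ac)
  qed
  \<comment> \<open>The last factors of the two products of length 2n+3 are 1 - q u^2 and 1 - q^2
    u^2 = (1 - u q)(1 + u q); the former matches the factor in front of the certificates.\<close>
  have last: "(1 - u * q) * (1 + u * q)\<^sup>2 * wz_term q (Suc n) (Suc n) = (1 - q * u\<^sup>2) * c"
  proof -
    have i: "Suc (Suc n) + Suc n = Suc (2 * Suc n)" by simp
    have uu: "q ^ (2 * (2 * Suc n)) = u\<^sup>2"
      by (simp only: u_def flip: power_mult) (simp only: mult.commute)
    have O: "?O (Suc (2 * Suc n)) = ?O (2 * Suc n) * (1 - q * u\<^sup>2)"
      by (simp only: qpoch_square_Suc power_add uu) simp
    have M: "?M (Suc (2 * Suc n)) = ?M (2 * Suc n) * ((1 - u * q) * (1 + u * q))"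
      by (simp only: qpoch_square_Suc power_add uu) algebra
    have o: "odd_term q (Suc n) = q ^ Suc n / (1 + u * q)" unfolding odd_term_def uq ..
    show ?thesis unfolding wz_term_def i O M c_def o using nz nzM
      by (simp add: divide_simps power2_eq_square del: power_Suc)
  qed
  have "(1 - u) * (1 - u * q) *
      ((1 + u * q)\<^sup>2 * (\<Sum>j\<le>Suc n. wz_term q (Suc n) j) - (1 + u)\<^sup>2 * ?S) = 0"
    using sum last unfolding cert sum.atMost_Suc by algebra
  then have *: "(1 + u * q)\<^sup>2 * (\<Sum>j\<le>Suc n. wz_term q (Suc n) j) = (1 + u)\<^sup>2 * ?S"
    using nz by simp
  have P: "qpoch (- (q\<^sup>2)) (q\<^sup>2) (Suc n) = qpoch (- (q\<^sup>2)) (q\<^sup>2) n * (1 + u)"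
    unfolding qpoch_square_Suc u_def by simp
  have Q: "qpoch (- q) (q\<^sup>2) (Suc (Suc n)) = qpoch (- q) (q\<^sup>2) (Suc n) * (1 + u * q)"
    unfolding qpoch_square_Suc(2)[of q "Suc n"] uq ..
  have "(\<Sum>j\<le>Suc n. wz_term q (Suc n) j) = (1 + u)\<^sup>2 * ?S / (1 + u * q)\<^sup>2"
    using * nz by (simp add: field_simps del: sum.atMost_Suc)
  then show ?case unfolding Suc.IH P Q by (simp add: power_mult_distrib)
qed

section \<open>Infinite products: limits and factorizations\<close>

lemma qpoch_LIMSEQ:
  assumes "norm q < 1"
  shows "qpoch x q \<longlonglongrightarrow> qpoch_inf x q"
  using has_prod_imp_tendsto'[OF has_prod_qpoch_inf[OF assms]]
  by (simp add: qpoch_def[abs_def])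

lemma qpoch_inf_nonzero:
  assumes "norm q < 1" "norm x < 1"
  shows "qpoch_inf x q \<noteq> 0"
  unfolding qpoch_inf_def
proof (rule prodinf_nonzero[OF convergent_prod_qpoch_inf[OF assms(1)]])
  fix i
  show "1 - x * q ^ i \<noteq> 0"
    using qpoch_nonzero[OF assms, of "Suc i"] by (simp add: qpoch_Suc)
qed

text \<open>Factorwise this is (1 - y)(1 + y) = 1 - y^2 with y = x q^i, followed by passage to the
  limit.\<close>

lemma qpoch_inf_mult_minus:
  assumes "norm q < 1"
  shows "qpoch_inf x q * qpoch_inf (- x) q = qpoch_inf (x\<^sup>2) (q\<^sup>2)"
proof -
  have q2: "norm (q\<^sup>2) < 1"
    using assms by (simp add: norm_power power_less_one_iff)
  have "qpoch x q n * qpoch (- x) q n = qpoch (x\<^sup>2) (q\<^sup>2) n" for n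
    by (simp add: qpoch_def flip: prod.distrib)
       (auto intro!: prod.cong simp: power2_eq_square power_mult_distrib algebra_simps)
  then show ?thesis
    using tendsto_mult[OF qpoch_LIMSEQ[OF assms, of x] qpoch_LIMSEQ[OF assms, of "- x"]]
      qpoch_LIMSEQ[OF q2, of "x\<^sup>2"] by (simp add: LIMSEQ_unique)
qed

text \<open>Even and odd exponents separate in the partial products of even length, a subsequence
  with the same limit.\<close>

lemma qpoch_inf_even_odd:
  assumes "norm q < 1"
  shows "qpoch_inf x q = qpoch_inf x (q\<^sup>2) * qpoch_inf (x * q) (q\<^sup>2)"
proof -
  have q2: "norm (q\<^sup>2) < 1"
    using assms by (simp add: norm_power power_less_one_iff)
  have split: "qpoch x q (2 * n) = qpoch x (q\<^sup>2) n * qpoch (x * q) (q\<^sup>2) n" for n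
    by (induction n) (simp_all add: qpoch_Suc power_mult)
  have "(\<lambda>n. qpoch x q (2 * n)) \<longlonglongrightarrow> qpoch_inf x q"
    using LIMSEQ_subseq_LIMSEQ[OF qpoch_LIMSEQ[OF assms], of "\<lambda>n. 2 * n" x]
    by (simp add: strict_mono_def o_def)
  moreover have "(\<lambda>n. qpoch x q (2 * n)) \<longlonglongrightarrow> qpoch_inf x (q\<^sup>2) * qpoch_inf (x * q) (q\<^sup>2)"
    unfolding split by (intro tendsto_mult qpoch_LIMSEQ q2)
  ultimately show ?thesis by (rule LIMSEQ_unique)
qed

section \<open>Closed form of the series A, and Euler's identity\<close>

lemma summable_norm_odd_term:
  assumes q: "norm q < 1"
  shows "summable (\<lambda>n. norm (odd_term q n))"
proof (rule summable_comparison_test)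
  show "\<exists>N. \<forall>n\<ge>N. norm (norm (odd_term q n)) \<le> norm q ^ n / (1 - norm q)"
  proof (intro exI allI impI)
    fix n
    have "norm q ^ (2 * n + 1) \<le> norm q"
      using q mult_left_mono[of "norm q ^ (2 * n)" 1 "norm q"] by (simp add: power_le_one)
    then have "1 - norm q \<le> 1 - norm (- (q ^ (2 * n + 1)))" by (simp only: norm_minus_cancel norm_power)
    also have "\<dots> \<le> norm (1 + q ^ (2 * n + 1))"
      using norm_triangle_ineq2[of 1 "- (q ^ (2 * n + 1))"] by simp
    finally show "norm (norm (odd_term q n)) \<le> norm q ^ n / (1 - norm q)"
      using q by (simp add: odd_term_def norm_divide norm_power frac_le)
  qed
  show "summable (\<lambda>n. norm q ^ n / (1 - norm q))"
    using q by (intro summable_divide summable_geometric) simp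
qed

text \<open>Tannery's theorem allows \<open>n\<close> to tend to infinity in
  \<open>finite_odd_sum\<close>. With all products infinite this gives A (q;q^2)^2 / (q^2;q^2)^2 =
  (-q^2;q^2)^2 / (-q;q^2)^2, and solving for A pairs each product with the one of opposite
  argument.\<close>

lemma odd_term_sums:
  assumes q: "norm q < 1"
  shows "odd_term q sums ((qpoch_inf (q ^ 4) (q ^ 4))\<^sup>2 / (qpoch_inf (q\<^sup>2) (q ^ 4))\<^sup>2)"
proof -
  let ?O = "qpoch q (q\<^sup>2)" and ?M = "qpoch (q\<^sup>2) (q\<^sup>2)"
  let ?Oi = "qpoch_inf q (q\<^sup>2)" and ?Mi = "qpoch_inf (q\<^sup>2) (q\<^sup>2)"
  let ?E = "qpoch_inf (- (q\<^sup>2)) (q\<^sup>2)" and ?F = "qpoch_inf (- q) (q\<^sup>2)"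
  have q2: "norm (q\<^sup>2) < 1"
    using q by (simp add: norm_power power_less_one_iff)
  have nz: "?Oi \<noteq> 0" "?Mi \<noteq> 0" "?F \<noteq> 0" using q q2 by (simp_all add: qpoch_inf_nonzero)
  note limO = qpoch_LIMSEQ[OF q2, of q] and limM = qpoch_LIMSEQ[OF q2, of "q\<^sup>2"]
  obtain K where K: "\<And>n. norm (?O n) \<le> K"
    using convergent_imp_Bseq[OF convergentI[OF limO]] unfolding Bseq_def by auto
  obtain L where L: "\<And>n. norm (inverse (?M n)) \<le> L"
    using convergent_imp_Bseq[OF convergentI[OF tendsto_inverse[OF limM nz(2)]]]
    unfolding Bseq_def by auto
  have KL: "K \<ge> 0" "L \<ge> 0" using K[of 0] L[of 0] norm_ge_zero order_trans by blast+
  \<comment> \<open>Extension by zero turns the finite sums into series; truncated subtraction would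
    otherwise leave spurious terms for \<open>k > n\<close>.\<close>
  define a where "a k n = (if k \<le> n then wz_term q n k else 0)" for k n
  define b where "b k = odd_term q k * (?Oi * ?Oi / (?Mi * ?Mi))" for k
  have lim: "(\<lambda>n. a k n) \<longlonglongrightarrow> b k" for k
  proof -
    have s1: "(\<lambda>n. f (n - k)) \<longlonglongrightarrow> l" if "f \<longlonglongrightarrow> l" for f :: "nat \<Rightarrow> complex" and l
      by (rule LIMSEQ_offset[where k = k]) (simp add: that)
    have s2: "(\<lambda>n. f (Suc n + k)) \<longlonglongrightarrow> l" if "f \<longlonglongrightarrow> l" for f :: "nat \<Rightarrow> complex" and l
      using LIMSEQ_ignore_initial_segment[OF that, of "Suc k"] by (simp add: add.commute)
    have "(\<lambda>n. wz_term q n k) \<longlonglongrightarrow> b k"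
      unfolding wz_term_def b_def
      by (intro tendsto_intros s1 s2[of ?O] s2[of ?M] limO limM) (use nz in auto)
    moreover have "eventually (\<lambda>n. wz_term q n k = a k n) sequentially"
      using eventually_ge_at_top[of k] by eventually_elim (simp add: a_def)
    ultimately show ?thesis by (rule Lim_transform_eventually)
  qed
  \<comment> \<open>Two finite products bounded by \<open>K\<close> and two reciprocals bounded by
    \<open>L\<close> occur in each summand, so the majorant is independent of
    \<open>n\<close>.\<close>
  have bound: "norm (a k n) \<le> norm (odd_term q k) * ((K * K) * (L * L))" for k n
  proof (cases "k \<le> n")
    case True
    have "wz_term q n k = odd_term q k * ((?O (n - k) * ?O (Suc n + k)) *
        (inverse (?M (Suc n + k)) * inverse (?M (n - k))))"
      by (simp add: wz_term_def divide_inverse)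
    then have "norm (wz_term q n k) = norm (odd_term q k) * ((norm (?O (n - k)) * norm (?O (Suc n + k))) *
        (norm (inverse (?M (Suc n + k))) * norm (inverse (?M (n - k)))))"
      by (simp only: norm_mult)
    also have "\<dots> \<le> norm (odd_term q k) * ((K * K) * (L * L))"
      by (intro mult_left_mono mult_mono K L) (use KL in auto)
    finally show ?thesis using True by (simp add: a_def)
  next
    case False
    then show ?thesis using KL by (simp add: a_def)
  qed
  have "(\<lambda>n. suminf (\<lambda>k. a k n)) \<longlonglongrightarrow> suminf b"
  proof -
    have "summable (\<lambda>k. norm (odd_term q k) * ((K * K) * (L * L)))"
      by (intro summable_mult2 summable_norm_odd_term q)
    then show ?thesis
      using tannerys_theorem[of a b sequentially "\<lambda>k. norm (odd_term q k) * ((K * K) * (L * L))"]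
        lim bound by (simp add: always_eventually)
  qed
  moreover have "suminf (\<lambda>k. a k n) = (qpoch (- (q\<^sup>2)) (q\<^sup>2) n)\<^sup>2 / (qpoch (- q) (q\<^sup>2) (Suc n))\<^sup>2" for n
  proof -
    have "suminf (\<lambda>k. a k n) = (\<Sum>k\<le>n. a k n)"
      by (rule suminf_finite) (auto simp: a_def)
    then show ?thesis using finite_odd_sum[OF q, of n] by (simp add: a_def)
  qed
  moreover have "(\<lambda>n. (qpoch (- (q\<^sup>2)) (q\<^sup>2) n)\<^sup>2 / (qpoch (- q) (q\<^sup>2) (Suc n))\<^sup>2) \<longlonglongrightarrow> ?E\<^sup>2 / ?F\<^sup>2"
    by (intro tendsto_intros qpoch_LIMSEQ[OF q2] LIMSEQ_Suc[OF qpoch_LIMSEQ[OF q2]]) (use nz in auto)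
  ultimately have "suminf b = ?E\<^sup>2 / ?F\<^sup>2" by (simp add: LIMSEQ_unique)
  moreover have summable: "summable (odd_term q)"
    using summable_norm_odd_term[OF q] by (rule summable_norm_cancel)
  moreover have "suminf b = suminf (odd_term q) * (?Oi * ?Oi / (?Mi * ?Mi))"
    unfolding b_def by (rule suminf_mult2[OF summable, symmetric])
  ultimately have "suminf (odd_term q) * (?Oi * ?Oi / (?Mi * ?Mi)) = ?E\<^sup>2 / ?F\<^sup>2" by simp
  then have "suminf (odd_term q) = (?Mi * ?E)\<^sup>2 / (?Oi * ?F)\<^sup>2"
    using nz by (simp add: field_simps power2_eq_square)
  moreover have "?Mi * ?E = qpoch_inf (q ^ 4) (q ^ 4)" "?Oi * ?F = qpoch_inf (q\<^sup>2) (q ^ 4)"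
    using qpoch_inf_mult_minus[OF q2] by (simp_all flip: power_mult)
  ultimately show ?thesis using summable_sums[OF summable] by simp
qed

text \<open>Both (-q;q)(q;q) = (q^2;q^2) and (q;q) = (q;q^2)(q^2;q^2) hold; the nonzero product
  (q^2;q^2) cancels.\<close>

lemma euler_qpoch_inf:
  assumes q: "norm q < 1"
  shows "qpoch_inf (- q) q * qpoch_inf q (q\<^sup>2) = 1"
proof -
  have "norm (q\<^sup>2) < 1"
    using q by (simp add: norm_power power_less_one_iff)
  then have "qpoch_inf (q\<^sup>2) (q\<^sup>2) \<noteq> 0" by (intro qpoch_inf_nonzero)
  moreover have "qpoch_inf q q = qpoch_inf q (q\<^sup>2) * qpoch_inf (q\<^sup>2) (q\<^sup>2)"
    using qpoch_inf_even_odd[OF q, of q] by (simp add: power2_eq_square)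
  ultimately show ?thesis using qpoch_inf_mult_minus[OF q, of q] by (auto simp: mult.commute)
qed

section \<open>Double series and the square of a sum\<close>

lemma abs_summable_on_product_nat:
  fixes f g :: "nat \<Rightarrow> 'a :: {real_normed_field, banach}"
  assumes "summable (\<lambda>n. norm (f n))" "summable (\<lambda>n. norm (g n))"
  shows "(\<lambda>(m, n). norm (f m * g n)) summable_on UNIV"
proof -
  have "(\<lambda>(m, n). norm (f m) * norm (g n)) summable_on Sigma UNIV (\<lambda>_. UNIV)"
  proof (rule summable_on_SigmaI[where g = "\<lambda>m. norm (f m) * (\<Sum>n. norm (g n))"])
    fix m
    have "((\<lambda>n. norm (g n)) has_sum (\<Sum>n. norm (g n))) UNIV"
      using assms(2) by (intro norm_summable_imp_has_sum summable_sums) simp_all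
    then show "((\<lambda>n. case (m, n) of (m, n) \<Rightarrow> norm (f m) * norm (g n)) has_sum
        norm (f m) * (\<Sum>n. norm (g n))) UNIV"
      by (simp add: has_sum_cmult_right)
  next
    show "(\<lambda>m. norm (f m) * (\<Sum>n. norm (g n))) summable_on UNIV"
      using assms(1) by (intro summable_on_cmult_left norm_summable_imp_summable_on) simp
  qed auto
  then show ?thesis by (simp add: norm_mult)
qed

text \<open>Bridge from unordered double sums to iterated series: each row is summable as a
  restriction, its value agrees with the ordinary series, and Fubini applies. Used on a function and
  on its transpose, it interchanges summations.\<close>

lemma sums_of_double_has_sum:
  fixes f :: "nat \<times> nat \<Rightarrow> 'a :: banach"
  assumes "(f has_sum S) UNIV" "\<And>m. (\<lambda>n. f (m, n)) sums R m"
  shows "R sums S"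
proof -
  have "((\<lambda>n. f (m, n)) has_sum R m) UNIV" for m
  proof -
    have "f summable_on range (Pair m)"
      using has_sum_imp_summable[OF assms(1)] by (rule summable_on_subset_banach) simp
    then have "(\<lambda>n. f (m, n)) summable_on UNIV"
      by (subst (asm) summable_on_reindex) (auto simp: inj_on_def o_def)
    then have *: "((\<lambda>n. f (m, n)) has_sum infsum (\<lambda>n. f (m, n)) UNIV) UNIV" by simp
    then show ?thesis
      using sums_unique2[OF has_sum_imp_sums[OF *] assms(2)] by simp
  qed
  then have "(R has_sum S) UNIV"
    using has_sum_SigmaD[of f UNIV "\<lambda>_. UNIV" S R] assms(1) by simp
  then show ?thesis by (rule has_sum_imp_sums)
qed

text \<open>The square is the sum of \<open>a m * a n\<close> over all pairs. Symmetry makes the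
  parts \<open>m < n\<close> and \<open>n < m\<close> equal, and the former is summed along its
  diagonals.\<close>

lemma square_sum_diagonals:
  fixes a :: "nat \<Rightarrow> 'a :: {real_normed_field, banach}"
  assumes a: "summable (\<lambda>n. norm (a n))"
    and diag: "\<And>d. (\<lambda>m. a m * a (m + d + 1)) sums D d"
  obtains s where "(\<lambda>m. (a m)\<^sup>2) sums s" "(\<lambda>d. 2 * D d) sums ((suminf a)\<^sup>2 - s)"
proof -
  let ?f = "\<lambda>(m, n). a m * a n"
  let ?L = "{(m, n :: nat). m < n}" and ?U = "{(m, n :: nat). n < m}" and ?E = "{(m, n :: nat). m = n}"
  have suma: "a sums suminf a" by (rule summable_sums[OF summable_norm_cancel[OF a]])
  have summable: "?f summable_on UNIV" 
    using abs_summable_on_product_nat[OF a a]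
    by - (rule abs_summable_summable, simp add: case_prod_unfold)
  then have summable': "?f summable_on A" for A by (rule summable_on_subset_banach) simp
  have "(?f has_sum infsum ?f UNIV) UNIV" by (rule has_sum_infsum[OF summable])
  then have "(\<lambda>m. a m * suminf a) sums infsum ?f UNIV"
  proof (rule sums_of_double_has_sum)
    show "(\<lambda>n. ?f (m, n)) sums (a m * suminf a)" for m
      unfolding prod.case by (rule sums_mult[OF suma])
  qed
  moreover have "(\<lambda>m. a m * suminf a) sums (suminf a * suminf a)"
    by (rule sums_mult2[OF suma])
  ultimately have total: "infsum ?f UNIV = (suminf a)\<^sup>2"
    unfolding power2_eq_square by (rule sums_unique2)
  have swap: "infsum ?f ?U = infsum ?f ?L"
    by (rule infsum_reindex_bij_witness[where i = prod.swap and j = prod.swap])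
       (auto simp: mult.commute)
  have "(?f has_sum infsum ?f ?E) ?E" by (rule has_sum_infsum[OF summable'])
  also have "?this \<longleftrightarrow> ((\<lambda>m. (a m)\<^sup>2) has_sum infsum ?f ?E) UNIV"
    by (rule has_sum_reindex_bij_witness[where i = "\<lambda>m. (m, m)" and j = fst])
       (auto simp: power2_eq_square)
  finally have E: "(\<lambda>m. (a m)\<^sup>2) sums infsum ?f ?E" by (rule has_sum_imp_sums)
  \<comment> \<open>Pairs with \<open>m < n\<close> are listed as (m, m + d + 1), so index
    \<open>d\<close> stands for the difference d + 1.\<close>
  have "(?f has_sum infsum ?f ?L) ?L" by (rule has_sum_infsum[OF summable'])
  also have "?this \<longleftrightarrow> ((\<lambda>(d, m). a m * a (m + d + 1)) has_sum infsum ?f ?L) UNIV"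
    by (rule has_sum_reindex_bij_witness[where i = "\<lambda>(d, m). (m, m + d + 1)"
          and j = "\<lambda>(m, n). (n - m - 1, m)"]) auto
  finally have L: "D sums infsum ?f ?L"
    by (rule sums_of_double_has_sum) (use diag in simp)
  have "UNIV = (?L \<union> ?U) \<union> ?E" by (auto intro: linorder_cases)
  then have "infsum ?f UNIV = infsum ?f ((?L \<union> ?U) \<union> ?E)"
    by (rule arg_cong[where f = "infsum ?f"])
  also have "\<dots> = infsum ?f (?L \<union> ?U) + infsum ?f ?E"
    by (rule infsum_Un_disjoint[OF summable' summable']) auto
  also have "infsum ?f (?L \<union> ?U) = infsum ?f ?L + infsum ?f ?U"
    by (rule infsum_Un_disjoint[OF summable' summable']) auto
  finally have "2 * infsum ?f ?L = (suminf a)\<^sup>2 - infsum ?f ?E"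
    unfolding total swap by simp
  with sums_mult[OF L, of 2] show ?thesis by (intro that[OF E]) (simp only:)
qed

section \<open>Telescoping along diagonals and antidiagonals\<close>

text \<open>A shift by \<open>d\<close> is a sum of \<open>d\<close> unit shifts; the one from
  \<open>m + i\<close> to \<open>m + i + 1\<close> telescopes to \<open>c - r i\<close>.\<close>

lemma telescope_shift_sums:
  fixes r :: "nat \<Rightarrow> 'a :: real_normed_vector"
  assumes "r \<longlonglongrightarrow> c"
  shows "(\<lambda>m. r (m + d) - r m) sums (\<Sum>i<d. c - r i)"
proof (induction d)
  case (Suc d)
  have "(\<lambda>m. r (Suc m + d) - r (m + d)) sums (c - r (0 + d))"
    by (rule telescope_sums) (rule LIMSEQ_ignore_initial_segment[OF assms])
  from sums_add[OF Suc.IH this] show ?case by simp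
qed simp

text \<open>Partial fractions express both kinds of products through
  \<open>r m = 1 / (1 + q ^ (2 * m + 1))\<close> with the common coefficient \<open>c d\<close>. The
  partial sums of \<open>r\<close> enter twice with opposite signs and cancel, leaving
  \<open>c d * of_nat (Suc d)\<close>.\<close>

lemma odd_term_diagonals:
  assumes q: "norm q < 1"
  obtains D where "\<And>d. (\<lambda>m. odd_term q m * odd_term q (m + d + 1)) sums D d"
    "\<And>d. 2 * D d + (\<Sum>i\<le>d. odd_term q i * odd_term q (d - i))
      = of_nat (Suc d) * q ^ d / (1 - q ^ (2 * Suc d))"
proof
  define r where "r m = 1 / (1 + q ^ (2 * m + 1))" for m
  define c where "c d = q ^ d / (1 - q ^ (2 * Suc d))" for d
  have nz: "1 + q ^ (2 * m + 1) \<noteq> 0" for m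
    using power_neq_one(2)[OF q, of "2 * m + 1"] by (simp add: add_eq_0_iff del: power_Suc)
  have nz': "1 - q ^ (2 * Suc d) \<noteq> 0" for d
    using power_neq_one(1)[OF q, of "2 * Suc d"] by simp
  have "(\<lambda>m. q ^ (2 * m + 1)) \<longlonglongrightarrow> 0"
    using LIMSEQ_subseq_LIMSEQ[OF LIMSEQ_power_zero[OF q], of "\<lambda>m. 2 * m + 1"]
    by (simp add: strict_mono_def o_def)
  then have "(\<lambda>m. 1 / (1 + q ^ (2 * m + 1))) \<longlonglongrightarrow> 1 / (1 + 0)"
    by (intro tendsto_divide tendsto_add tendsto_const) simp_all
  then have r: "r \<longlonglongrightarrow> 1" by (simp add: r_def[abs_def])
  \<comment> \<open>This supplies the witness for \<open>D d\<close>; the 1 in its summands is the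
    limit of \<open>r\<close>.\<close>
  show "(\<lambda>m. odd_term q m * odd_term q (m + d + 1)) sums (c d * (\<Sum>i<Suc d. 1 - r i))" for d
  proof -
    have "odd_term q m * odd_term q (m + d + 1) = c d * (r (m + Suc d) - r m)" for m
    proof -
      define y where "y = q ^ (2 * m + 1)"
      define z where "z = q ^ (2 * Suc d)"
      have "2 * (m + d + 1) + 1 = (2 * m + 1) + 2 * Suc d" "2 * (m + Suc d) + 1 = (2 * m + 1) + 2 * Suc d"
        by simp_all
      then have e: "q ^ (2 * (m + d + 1) + 1) = y * z" "q ^ (2 * (m + Suc d) + 1) = y * z"
        by (simp_all only: power_add y_def z_def)
      have n: "1 + y \<noteq> 0" "1 + y * z \<noteq> 0" "1 - z \<noteq> 0"
        using nz[of m] nz[of "m + d + 1"] nz'[of d] unfolding e by (simp_all only: y_def z_def simp_thms)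
      have "q ^ m * q ^ (m + d + 1) = q ^ d * y"
        by (simp add: y_def power_add mult_2)
      then have "odd_term q m * odd_term q (m + d + 1) = q ^ d * y / ((1 + y) * (1 + y * z))"
        unfolding odd_term_def e y_def[symmetric] by simp
      also have "\<dots> = q ^ d / (1 - z) * (1 / (1 + y * z) - 1 / (1 + y))"
        using n by (simp add: divide_simps) algebra
      finally show ?thesis unfolding c_def r_def e unfolding y_def z_def .
    qed
    then show ?thesis using sums_mult[OF telescope_shift_sums[OF r, of "Suc d"]] by simp
  qed
  show "2 * (c d * (\<Sum>i<Suc d. 1 - r i)) + (\<Sum>i\<le>d. odd_term q i * odd_term q (d - i))
      = of_nat (Suc d) * q ^ d / (1 - q ^ (2 * Suc d))" for d
  proof -
    have "odd_term q i * odd_term q (d - i) = c d * (r i + r (d - i) - 1)" if "i \<le> d" for i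
    proof -
      define y where "y = q ^ (2 * i + 1)"
      define z where "z = q ^ (2 * (d - i) + 1)"
      have "2 * Suc d = (2 * i + 1) + (2 * (d - i) + 1)" using that by simp
      then have e: "q ^ (2 * Suc d) = y * z"
        by (simp only: power_add y_def z_def)
      have n: "1 + y \<noteq> 0" "1 + z \<noteq> 0" "1 - y * z \<noteq> 0"
        using nz[of i] nz[of "d - i"] nz'[of d] unfolding e by (simp_all only: y_def z_def simp_thms)
      have "q ^ i * q ^ (d - i) = q ^ d" using that by (simp flip: power_add)
      then have "odd_term q i * odd_term q (d - i) = q ^ d / ((1 + y) * (1 + z))"
        unfolding odd_term_def y_def z_def by simp
      also have "\<dots> = q ^ d / (1 - y * z) * (1 / (1 + y) + 1 / (1 + z) - 1)"
        using n by (simp add: divide_simps) algebra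
      finally show ?thesis unfolding c_def r_def e unfolding y_def z_def .
    qed
    then have "(\<Sum>i\<le>d. odd_term q i * odd_term q (d - i)) = (\<Sum>i\<le>d. c d * (r i + r (d - i) - 1))"
      by (intro sum.cong) auto
    also have "\<dots> = c d * (\<Sum>i\<le>d. r i + r (d - i) - 1)" by (simp only: sum_distrib_left)
    also have "(\<Sum>i\<le>d. r i + r (d - i) - 1) = 2 * (\<Sum>i\<le>d. r i) - of_nat (Suc d)"
    proof -
      have "(\<Sum>i\<le>d. r (d - i)) = (\<Sum>i\<le>d. r i)"
        using sum.nat_diff_reindex[of r "Suc d"] by (simp add: lessThan_Suc_atMost)
      then show ?thesis by (simp add: sum.distrib sum_subtractf)
    qed
    finally have "(\<Sum>i\<le>d. odd_term q i * odd_term q (d - i))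
        = c d * (2 * (\<Sum>i\<le>d. r i) - of_nat (Suc d))" .
    moreover have "(\<Sum>i<Suc d. 1 - r i) = of_nat (Suc d) - (\<Sum>i\<le>d. r i)"
      by (simp add: lessThan_Suc_atMost sum_subtractf)
    moreover have "of_nat (Suc d) * q ^ d / (1 - q ^ (2 * Suc d)) = c d * of_nat (Suc d)"
      by (simp add: c_def)
    ultimately show ?thesis by (simp only:) (simp only: algebra_simps, simp)
  qed
qed

section \<open>Interchange of summations in a Lambert series\<close>

text \<open>Both series are iterated sums of (d+1) q^((d+1)(2j+1)-1). Summing over \<open>j\<close>
  first is a geometric series, summing over \<open>d\<close> first is the derivative of one.\<close>

lemma double_lambert_sums:
  fixes q :: "'a :: {real_normed_field, banach}"
  assumes q: "norm q < 1"
  shows "\<exists>S. (\<lambda>d. of_nat (Suc d) * q ^ d / (1 - q ^ (2 * Suc d))) sums S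
    \<and> (\<lambda>j. q ^ (2 * j) / (1 - q ^ (2 * j + 1))\<^sup>2) sums S"
proof -
  define f where "f = (\<lambda>(d, j). of_nat (Suc d) * q ^ (d + 2 * j + 2 * d * j))"
  have "(\<lambda>(d, j). norm (real (Suc d) * norm q ^ d * norm q ^ (2 * j))) summable_on UNIV"
  proof (rule abs_summable_on_product_nat)
    show "summable (\<lambda>n. norm (real (Suc n) * norm q ^ n))"
      using geometric_deriv_sums[of "norm q"] q by (simp add: sums_iff abs_mult del: of_nat_Suc)
    have "summable (\<lambda>n. ((norm q)\<^sup>2) ^ n)"
      using q by (intro summable_geometric) (simp add: power_less_one_iff)
    then show "summable (\<lambda>n. norm (norm q ^ (2 * n)))"
      by (simp add: power_mult)
  qed
  then have "(\<lambda>x. norm (f x)) summable_on UNIV"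
  proof (rule Infinite_Sum.abs_summable_on_comparison_test')
    fix x :: "nat \<times> nat"
    obtain d j where x: "x = (d, j)" by fastforce
    \<comment> \<open>Dropping the mixed term \<open>2 * d * j\<close> of the exponent leaves a
      majorant that is a product of two summable sequences.\<close>
    have "norm q ^ (d + 2 * j + 2 * d * j) \<le> norm q ^ (d + 2 * j)"
      using q by (intro power_decreasing) auto
    then have "real (Suc d) * norm q ^ (d + 2 * j + 2 * d * j) \<le> real (Suc d) * (norm q ^ d * norm q ^ (2 * j))"
      by (intro mult_left_mono) (simp_all add: power_add)
    then show "norm (f x) \<le> (case x of (d, j) \<Rightarrow> norm (real (Suc d) * norm q ^ d * norm q ^ (2 * j)))"
      by (simp add: x f_def norm_mult norm_power abs_mult mult.assoc del: of_nat_Suc)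
  qed
  then have f: "(f has_sum infsum f UNIV) UNIV" by (simp add: abs_summable_summable)
  then have f': "((\<lambda>(j, d). f (d, j)) has_sum infsum f UNIV) UNIV"
    by (subst has_sum_reindex_bij_witness[where i = prod.swap and j = prod.swap and h = f and T = UNIV]) auto
  show ?thesis
  proof (intro exI conjI)
    show "(\<lambda>d. of_nat (Suc d) * q ^ d / (1 - q ^ (2 * Suc d))) sums infsum f UNIV"
    proof (rule sums_of_double_has_sum[OF f])
      fix d
      have e: "f (d, j) = of_nat (Suc d) * q ^ d * (q ^ (2 * Suc d)) ^ j" for j
      proof -
        have n: "d + 2 * j + 2 * d * j = d + 2 * Suc d * j" by simp
        show ?thesis unfolding f_def prod.case n by (simp only: power_add power_mult mult.assoc)
      qed
      have "norm (q ^ (2 * Suc d)) < 1"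
        using q by (simp add: norm_power power_less_one_iff del: mult_Suc_right)
      from sums_mult[OF geometric_sums[OF this], of "of_nat (Suc d) * q ^ d"]
      show "(\<lambda>j. f (d, j)) sums (of_nat (Suc d) * q ^ d / (1 - q ^ (2 * Suc d)))"
        unfolding e by (simp only: times_divide_eq_right mult_1_right)
    qed
    show "(\<lambda>j. q ^ (2 * j) / (1 - q ^ (2 * j + 1))\<^sup>2) sums infsum f UNIV"
    proof (rule sums_of_double_has_sum[OF f'])
      fix j
      have e: "f (d, j) = q ^ (2 * j) * (of_nat (Suc d) * (q ^ (2 * j + 1)) ^ d)" for d
      proof -
        have "d + 2 * j + 2 * d * j = 2 * j + (2 * j + 1) * d" by (simp add: algebra_simps)
        then have "q ^ (d + 2 * j + 2 * d * j) = q ^ (2 * j) * (q ^ (2 * j + 1)) ^ d"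
          by (simp only: power_add[of q "2 * j" "(2 * j + 1) * d"] power_mult[of q "2 * j + 1" d])
        then show ?thesis by (simp only: f_def prod.case mult.left_commute)
      qed
      have "norm (q ^ (2 * j + 1)) < 1"
        using q by (simp add: norm_power power_less_one_iff del: power_Suc)
      from sums_mult[OF geometric_deriv_sums[OF this], of "q ^ (2 * j)"]
      show "(\<lambda>d. case (j, d) of (j, d) \<Rightarrow> f (d, j)) sums (q ^ (2 * j) / (1 - q ^ (2 * j + 1))\<^sup>2)"
        unfolding e prod.case times_divide_eq_right mult_1_right .
    qed
  qed
qed

section \<open>Combination of the two expansions of the squared series\<close>

theorem theorem2p2:
  fixes q :: complex
  assumes "norm q < 1"
  shows "(\<lambda>k::nat. (1 + q ^ (4 * k + 2)) / (1 + q ^ (2 * k + 1)) ^ 2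
                  * (q ^ (2 * k) / (1 - q ^ (2 * k + 1)) ^ 2))
         sums (qpoch_inf (- (q ^ 2)) (q ^ 2) ^ 2 * qpoch_inf (q ^ 4) (q ^ 4) ^ 4
               / qpoch_inf (q ^ 2) (q ^ 4) ^ 2)"
proof -
  define A where "A = (qpoch_inf (q ^ 4) (q ^ 4))\<^sup>2 / (qpoch_inf (q\<^sup>2) (q ^ 4))\<^sup>2"
  have q2: "norm (q\<^sup>2) < 1"
    using assms by (simp add: norm_power power_less_one_iff)
  note a = summable_norm_odd_term[OF assms]
  have A: "suminf (odd_term q) = A"
    using odd_term_sums[OF assms] unfolding A_def by (simp add: sums_iff)
  obtain D where D: "\<And>d. (\<lambda>m. odd_term q m * odd_term q (m + d + 1)) sums D d"
    "\<And>d. 2 * D d + (\<Sum>i\<le>d. odd_term q i * odd_term q (d - i))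
      = of_nat (Suc d) * q ^ d / (1 - q ^ (2 * Suc d))"
    using odd_term_diagonals[OF assms] by blast
  obtain S where S: "(\<lambda>d. of_nat (Suc d) * q ^ d / (1 - q ^ (2 * Suc d))) sums S"
    "(\<lambda>j. q ^ (2 * j) / (1 - q ^ (2 * j + 1))\<^sup>2) sums S"
    using double_lambert_sums[OF assms] by blast
  obtain s where s: "(\<lambda>m. (odd_term q m)\<^sup>2) sums s" "(\<lambda>d. 2 * D d) sums (A\<^sup>2 - s)"
    using square_sum_diagonals[OF a D(1)] unfolding A by blast
  \<comment> \<open>The diagonals contribute \<open>A\<^sup>2 - s\<close>, and the antidiagonals, as
    a Cauchy product, another \<open>A * A\<close>.\<close>
  have "(\<lambda>d. 2 * D d + (\<Sum>i\<le>d. odd_term q i * odd_term q (d - i))) sums ((A\<^sup>2 - s) + A * A)"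
    using sums_add[OF s(2) Cauchy_product_sums[OF a a]] unfolding A .
  then have "S = 2 * A\<^sup>2 - s"
    unfolding D(2) using sums_unique2[OF S(1)] by (simp add: power2_eq_square)
  then have "(\<lambda>k. q ^ (2 * k) / (1 - q ^ (2 * k + 1))\<^sup>2 + (odd_term q k)\<^sup>2) sums (2 * A\<^sup>2)"
    using sums_add[OF S(2) s(1)] by simp
  from sums_divide[OF this, of 2]
  have "(\<lambda>k. (q ^ (2 * k) / (1 - q ^ (2 * k + 1))\<^sup>2 + (odd_term q k)\<^sup>2) / 2) sums A\<^sup>2" by simp
  \<comment> \<open>With x = q^(2k+1) this rests on 1/(1-x)^2 + 1/(1+x)^2 = 2 (1+x^2) / ((1-x)^2
    (1+x)^2).\<close>
  moreover have "(q ^ (2 * k) / (1 - q ^ (2 * k + 1))\<^sup>2 + (odd_term q k)\<^sup>2) / 2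
      = (1 + q ^ (4 * k + 2)) / (1 + q ^ (2 * k + 1)) ^ 2 * (q ^ (2 * k) / (1 - q ^ (2 * k + 1)) ^ 2)" for k
  proof -
    define x where "x = q ^ (2 * k + 1)"
    have "1 + x \<noteq> 0" "1 - x \<noteq> 0"
      using power_neq_one[OF assms, of "2 * k + 1"] unfolding x_def
      by (auto simp: add_eq_0_iff simp del: power_Suc)
    moreover have e1: "q ^ (4 * k + 2) = x\<^sup>2"
    proof -
      have "4 * k + 2 = (2 * k + 1) * 2" by simp
      then show ?thesis by (simp only: x_def power_mult)
    qed
    moreover have e2: "(odd_term q k)\<^sup>2 = q ^ (2 * k) / (1 + x)\<^sup>2"
      by (simp add: odd_term_def x_def power_divide mult.commute flip: power_mult)
    ultimately show ?thesis
      unfolding x_def[symmetric] e1 e2 by (simp add: divide_simps) algebra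
  qed
  \<comment> \<open>Euler's identity in base q^2 trades two of the four factors 1/(q^2;q^4) in
    \<open>A\<^sup>2\<close> for (-q^2;q^2)^2.\<close>
  moreover have "A\<^sup>2 = qpoch_inf (- (q ^ 2)) (q ^ 2) ^ 2 * qpoch_inf (q ^ 4) (q ^ 4) ^ 4
      / qpoch_inf (q ^ 2) (q ^ 4) ^ 2"
  proof -
    have "qpoch_inf (- (q\<^sup>2)) (q\<^sup>2) * qpoch_inf (q\<^sup>2) (q ^ 4) = 1"
      using euler_qpoch_inf[OF q2] by (simp flip: power_mult)
    then have "qpoch_inf (- (q\<^sup>2)) (q\<^sup>2) = 1 / qpoch_inf (q\<^sup>2) (q ^ 4)"
      by (metis mult_zero_right nonzero_eq_divide_eq zero_neq_one)
    then show ?thesis by (simp add: A_def power_divide flip: power_mult)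
  qed
  ultimately show ?thesis by simp
qed

end
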